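(* Let $g\geqslant1$. The Volterra map $\mathcal{V}_g$ can be written in the compact form $$\mathbf{L}(x)\mathbf{M}(x)=\mathbf{M}(x)\widetilde{\mathbf{L}}(x),$$ where $\mathbf{L}(x)=\begin{pmatrix}\mathcal{P}(x)&\mathcal{R}(x)\\ \mathcal{Q}(x)&-\mathcal{P}(x)\end{pmatrix}$, $\widetilde{\mathbf{L}}(x)$ is $\mathbf{L}(x)$ with $\mathcal{P},\mathcal{Q},\mathcal{R}$ replaced by $\tilde{\mathcal{P}},\tilde{\mathcal{Q}},\tilde{\mathcal{R}}$, and $\mathbf{M}(x)=\begin{pmatrix}1&-wx\\1&0\end{pmatrix}$ with $w=-\frac12(2p_1-q_1+r_1)$. As a consequence, the $2g+1$ polynomial functions $H_1,\dots,H_{2g+1}$ on $M_g$ defined by $$\mathcal{P}(x)^2+\mathcal{Q}(x)\mathcal{R}(x)=1+\sum_{i=1}^{2g+1}H_ix^i$$ are invariants of the Volterra map, i.e. $\tilde H_i=H_i$ for $i=1,\dots,2g+1$.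
   Context: $M_g$ is the affine space of triplets $(\mathcal{P},\mathcal{Q},\mathcal{R})$ of complex polynomials $\mathcal{P}=1+\sum_{i=1}^gp_ix^i$, $\mathcal{Q}=2+\sum_{i=1}^gq_ix^i$, $\mathcal{R}=\sum_{i=1}^{g+1}r_ix^i$. The Volterra map $\mathcal{V}_g:M_g\dashrightarrow M_g$, $(\mathcal{P},\mathcal{Q},\mathcal{R})\mapsto(\tilde{\mathcal{P}},\tilde{\mathcal{Q}},\tilde{\mathcal{R}})$, is defined where $w=-\frac12(2p_1-q_1+r_1)\neq0$ by $\tilde{\mathcal{P}}=\mathcal{Q}-\mathcal{P}$, $\tilde{\mathcal{Q}}=\dfrac{2\mathcal{P}-\mathcal{Q}+\mathcal{R}}{-wx}$, $\tilde{\mathcal{R}}=-wx\mathcal{Q}$. For a function $H$ on $M_g$, $\tilde H$ denotes $H\circ\mathcal{V}_g$. *)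

theory Defs
  imports "HOL-Analysis.Analysis" "HOL-Computational_Algebra.Polynomial"
begin

type_synonym triple = "complex poly \<times> complex poly \<times> complex poly"

definition phase_space :: "nat \<Rightarrow> triple set" where
  "phase_space g =
    {(1 + (\<Sum>i=1..g. monom (p i) i),
      2 + (\<Sum>i=1..g. monom (q i) i),
      (\<Sum>i=1..g+1. monom (r i) i)) | p q r. True}"

definition volterra_w :: "triple \<Rightarrow> complex" where
  "volterra_w = (\<lambda>(P, Q, R). - (1/2) * (2 * coeff P 1 - coeff Q 1 + coeff R 1))"

definition volterra_domain :: "nat \<Rightarrow> triple set" where
  "volterra_domain g = {t \<in> phase_space g. volterra_w t \<noteq> 0}"

text \<open>
  Only meaningful on \<open>volterra_domain g\<close>. There the polynomial division \<open>div\<close> by \<open>- w x\<close> has no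
  remainder (\<open>volterra_div_exact\<close> below), so it is the quotient of the defining formula.
\<close>
definition volterra :: "triple \<Rightarrow> triple" where
  "volterra = (\<lambda>(P, Q, R). let wx = monom (volterra_w (P, Q, R)) 1 in
    (Q - P, (2 * P - Q + R) div (- wx), - wx * Q))"

definition lax_L :: "triple \<Rightarrow> complex poly ^ 2 ^ 2" where
  "lax_L = (\<lambda>(P, Q, R). vector [vector [P, R], vector [Q, - P]])"

definition lax_M :: "triple \<Rightarrow> complex poly ^ 2 ^ 2" where
  "lax_M t = vector [vector [1, - monom (volterra_w t) 1], vector [1, 0]]"

definition spectral_poly :: "triple \<Rightarrow> complex poly" where
  "spectral_poly = (\<lambda>(P, Q, R). P ^ 2 + Q * R)"

definition volterra_H :: "nat \<Rightarrow> triple \<Rightarrow> complex" where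
  "volterra_H i t = coeff (spectral_poly t) i"

text \<open>
  Polynomials in the affine coordinates \<open>p\<^sub>i\<close>, \<open>q\<^sub>i\<close>, \<open>r\<^sub>i\<close>; rule \<open>cong\<close> says that only the values
  on \<open>phase_space g\<close> matter.
\<close>
inductive polynomial_on_phase_space :: "nat \<Rightarrow> (triple \<Rightarrow> complex) \<Rightarrow> bool" for g where
  const: "polynomial_on_phase_space g (\<lambda>_. c)"
| p: "i \<in> {1..g} \<Longrightarrow> polynomial_on_phase_space g (\<lambda>(P, Q, R). coeff P i)"
| q: "i \<in> {1..g} \<Longrightarrow> polynomial_on_phase_space g (\<lambda>(P, Q, R). coeff Q i)"
| r: "i \<in> {1..g+1} \<Longrightarrow> polynomial_on_phase_space g (\<lambda>(P, Q, R). coeff R i)"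
| add: "polynomial_on_phase_space g f \<Longrightarrow> polynomial_on_phase_space g h
    \<Longrightarrow> polynomial_on_phase_space g (\<lambda>t. f t + h t)"
| mult: "polynomial_on_phase_space g f \<Longrightarrow> polynomial_on_phase_space g h
    \<Longrightarrow> polynomial_on_phase_space g (\<lambda>t. f t * h t)"
| cong: "polynomial_on_phase_space g f \<Longrightarrow> (\<And>t. t \<in> phase_space g \<Longrightarrow> h t = f t)
    \<Longrightarrow> polynomial_on_phase_space g h"

lemma coeff_sum_monom:
  "coeff (\<Sum>i=Suc 0..n. monom (a i) i) k = (if 1 \<le> k \<and> k \<le> n then a k else (0::complex))"
  by (auto simp: coeff_sum coeff_monom sum.delta)

lemma poly_eq_sum_monom:
  assumes "coeff A 0 = (0::complex)" "\<forall>k>n. coeff A k = 0"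
  shows "\<exists>a. A = (\<Sum>i=1..n. monom (a i) i)"
proof
  show "A = (\<Sum>i=1..n. monom (coeff A i) i)"
    using assms by (intro poly_eqI) (auto simp: coeff_sum_monom not_le Suc_le_eq)
qed

lemma coeff_two: "coeff (2 :: complex poly) k = (if k = 0 then 2 else 0)"
  by (auto simp: numeral_poly coeff_pCons split: nat.splits)

lemma phase_space_iff:
  "(P, Q, R) \<in> phase_space g \<longleftrightarrow>
    coeff P 0 = 1 \<and> (\<forall>k>g. coeff P k = 0) \<and>
    coeff Q 0 = 2 \<and> (\<forall>k>g. coeff Q k = 0) \<and>
    coeff R 0 = 0 \<and> (\<forall>k>g+1. coeff R k = 0)"
    (is "?l \<longleftrightarrow> ?r")
proof
  assume ?l
  then show ?r by (auto simp: phase_space_def coeff_sum_monom coeff_two simp del: sum.cl_ivl_Suc)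
next
  assume r: ?r
  obtain p where p: "P - 1 = (\<Sum>i=1..g. monom (p i) i)"
    using poly_eq_sum_monom[of "P - 1" g] r by auto
  obtain q where q: "Q - 2 = (\<Sum>i=1..g. monom (q i) i)"
    using poly_eq_sum_monom[of "Q - 2" g] r by (auto simp: coeff_two)
  obtain r where r: "R = (\<Sum>i=1..g+1. monom (r i) i)"
    using poly_eq_sum_monom[of R "g + 1"] r by blast
  have "P = 1 + (\<Sum>i=1..g. monom (p i) i)" "Q = 2 + (\<Sum>i=1..g. monom (q i) i)"
    unfolding p[symmetric] q[symmetric] by simp_all
  with r have "(P, Q, R) = (1 + (\<Sum>i=1..g. monom (p i) i),
      2 + (\<Sum>i=1..g. monom (q i) i), (\<Sum>i=1..g+1. monom (r i) i)) \<and> True"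
    by (simp only: simp_thms)
  then show ?l unfolding phase_space_def mem_Collect_eq by (intro exI)
qed

lemma coeff_two_mult: "coeff (2 * A) k = 2 * coeff (A :: complex poly) k"
  by (simp only: mult_2 coeff_add)

lemma volterra_div_exact:
  assumes "(P, Q, R) \<in> volterra_domain g"
  shows "- monom (volterra_w (P, Q, R)) 1 dvd 2 * P - Q + R"
proof -
  let ?w = "volterra_w (P, Q, R)" and ?A = "2 * P - Q + R"
  have w: "?w \<noteq> 0" and c: "coeff ?A 0 = 0"
    using assms by (auto simp: volterra_domain_def phase_space_iff coeff_two_mult
        simp del: coeff_mult_0)
  obtain a B where AB: "?A = pCons a B" by (cases ?A)
  with c have "?A = - monom ?w 1 * smult (- 1 / ?w) B"
    using w by (simp add: monom_Suc monom_0)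
  then show ?thesis by (metis dvd_triv_left)
qed

lemma volterra_in_phase_space:
  assumes "t \<in> volterra_domain g"
  shows "volterra t \<in> phase_space g"
proof -
  obtain P Q R where t: "t = (P, Q, R)" by (cases t)
  let ?w = "volterra_w (P, Q, R)" and ?A = "2 * P - Q + R"
  define B where "B = ?A div (- monom ?w 1)"
  have w: "?w \<noteq> 0" and M: "(P, Q, R) \<in> phase_space g"
    using assms by (auto simp: t volterra_domain_def)
  have "?A = - monom ?w 1 * B"
    using volterra_div_exact assms unfolding t B_def by (metis dvd_mult_div_cancel)
  then have A: "coeff ?A (Suc k) = - ?w * coeff B k" for k
    by (simp add: coeff_monom_mult)
  have "- ?w * coeff B 0 = - ?w * 2"
    unfolding A[symmetric] by (simp add: coeff_two_mult volterra_w_def)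
  then have B0: "coeff B 0 = 2" using w by (metis mult_left_cancel neg_equal_0_iff_equal)
  have Bk: "coeff B k = 0" if "k > g" for k
  proof -
    have "coeff ?A (Suc k) = 0" using M that by (simp add: phase_space_iff coeff_two_mult)
    then show ?thesis using A w by auto
  qed
  have "volterra t = (Q - P, B, - monom ?w 1 * Q)"
    by (simp add: t volterra_def Let_def B_def)
  also have "\<dots> \<in> phase_space g"
    using M B0 Bk by (auto simp: phase_space_iff coeff_monom_mult)
  finally show ?thesis .
qed

end

theory Submission
  imports Defs
begin

text \<open>
  The four entries of \<open>L M = M L'\<close> say exactly \<open>P' = Q - P\<close>, \<open>- w x Q' = 2 P - Q + R\<close>,
  \<open>R' = - w x Q\<close>, plus one redundant equation. As \<open>w x\<close> is not a zero divisor, this determines the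
  image triple. Substituting these equations into \<open>P'\<^sup>2 + Q' R' = (Q - P)\<^sup>2 - w x Q' Q\<close> gives back
  \<open>P\<^sup>2 + Q R\<close>, so no division is needed for the invariance either.
\<close>

lemma lax_equation_iff:
  fixes P Q R P' Q' R' :: "complex poly"
  defines "wx \<equiv> monom (volterra_w (P, Q, R)) 1"
  shows "lax_L (P, Q, R) ** lax_M (P, Q, R) = lax_M (P, Q, R) ** lax_L (P', Q', R') \<longleftrightarrow>
    P' = Q - P \<and> 2 * P - Q + R = - wx * Q' \<and> R' = - wx * Q"
proof -
  have "lax_L (P, Q, R) ** lax_M (P, Q, R) = lax_M (P, Q, R) ** lax_L (P', Q', R') \<longleftrightarrow>
    P + R = P' - wx * Q' \<and> - (P * wx) = R' + wx * P' \<and> Q - P = P' \<and> - (Q * wx) = R'"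
    unfolding lax_L_def lax_M_def wx_def
    by (simp add: vec_eq_iff forall_2 matrix_matrix_mult_def sum_2 conj_ac)
  \<comment> \<open>The redundant entry is - P w x = R' + w x P': it follows from P' = Q - P and R'
    = - w x Q.\<close>
  also have "\<dots> \<longleftrightarrow> P' = Q - P \<and> 2 * P - Q + R = - wx * Q' \<and> R' = - wx * Q"
    by (auto simp: algebra_simps)
  finally show ?thesis .
qed

lemma lax_equation_unique:
  assumes "volterra_w t \<noteq> 0" "lax_L t ** lax_M t = lax_M t ** lax_L t'"
  shows "t' = volterra t"
proof -
  obtain P Q R P' Q' R' where t: "t = (P, Q, R)" and t': "t' = (P', Q', R')"
    by (metis prod_cases3)
  let ?wx = "monom (volterra_w (P, Q, R)) 1"
  have eqs: "P' = Q - P" "2 * P - Q + R = - ?wx * Q'" "R' = - ?wx * Q"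
    using assms(2) by (simp_all only: t t' lax_equation_iff)
  have "- ?wx \<noteq> 0" using assms(1) by (simp add: t)
  then have "(2 * P - Q + R) div - ?wx = Q'"
    unfolding eqs(2) by (rule nonzero_mult_div_cancel_left)
  with eqs show ?thesis by (simp add: t t' volterra_def Let_def)
qed

lemma volterra_lax_equation:
  assumes "t \<in> volterra_domain g"
  shows "lax_L t ** lax_M t = lax_M t ** lax_L (volterra t)"
proof -
  obtain P Q R where t: "t = (P, Q, R)" by (cases t)
  \<comment> \<open>\<open>div\<close> is Euclidean division, so multiplying back by - w x recovers
    2 P - Q + R only because the remainder vanishes.\<close>
  have "- monom (volterra_w (P, Q, R)) 1 dvd 2 * P - Q + R"
    using assms unfolding t by (rule volterra_div_exact)
  from dvd_mult_div_cancel[OF this] show ?thesis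
    by (simp only: t volterra_def Let_def prod.case lax_equation_iff simp_thms)
qed

text \<open>\<open>spectral_poly\<close> is - det L, so this is the similarity invariance of the
  determinant, obtained by substitution instead of inverting M, whose determinant is w x.\<close>

lemma spectral_poly_eqI:
  assumes "lax_L t ** lax_M t = lax_M t ** lax_L t'"
  shows "spectral_poly t' = spectral_poly t"
proof -
  obtain P Q R P' Q' R' where t: "t = (P, Q, R)" and t': "t' = (P', Q', R')"
    by (metis prod_cases3)
  let ?wx = "monom (volterra_w (P, Q, R)) 1"
  have eqs: "P' = Q - P" "2 * P - Q + R = - ?wx * Q'" "R' = - ?wx * Q"
    using assms by (simp_all only: t t' lax_equation_iff)
  have "P' ^ 2 + Q' * R' = (Q - P) ^ 2 + Q * (- ?wx * Q')"
    by (simp add: eqs(1,3) mult_ac)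
  \<comment> \<open>Replacing - w x Q' by 2 P - Q + R lets the Q^2 and P Q terms cancel.\<close>
  also have "\<dots> = P ^ 2 + Q * R"
    unfolding eqs(2)[symmetric] by (simp add: power2_eq_square algebra_simps)
  finally show ?thesis by (simp add: t t' spectral_poly_def)
qed

lemma volterra_H_expand:
  "volterra_H i (P, Q, R) =
    (\<Sum>j\<le>i. coeff P j * coeff P (i - j)) + (\<Sum>j\<le>i. coeff Q j * coeff R (i - j))"
  by (simp add: volterra_H_def spectral_poly_def power2_eq_square coeff_mult)

lemma volterra_H_0:
  assumes "t \<in> phase_space g"
  shows "volterra_H 0 t = 1"
  using assms by (cases t) (simp add: volterra_H_expand phase_space_iff)

lemma volterra_H_eq_0:
  assumes "t \<in> phase_space g" "i > 2 * g + 1"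
  shows "volterra_H i t = 0"
proof -
  obtain P Q R where t: "t = (P, Q, R)" by (cases t)
  have P: "coeff P j = 0" and Q: "coeff Q j = 0" if "j > g" for j
    using assms(1) that by (simp_all add: t phase_space_iff)
  have R: "coeff R j = 0" if "j > g + 1" for j
    using assms(1) that by (simp add: t phase_space_iff)
  \<comment> \<open>If j \<le> g, then i > 2 g + 1 forces i - j > g + 1, so in either case one
    factor lies beyond its degree bound.\<close>
  have "coeff P j * coeff P (i - j) = 0" "coeff Q j * coeff R (i - j) = 0" for j
    using P[of j] P[of "i - j"] Q[of j] R[of "i - j"] assms(2) by (cases "j > g"; simp)+
  then show ?thesis by (simp only: t volterra_H_expand sum.neutral_const add_0)
qed

lemma spectral_poly_expansion:
  assumes "t \<in> phase_space g"
  shows "spectral_poly t = 1 + (\<Sum>i=1..2*g+1. monom (volterra_H i t) i)"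
proof (rule poly_eqI)
  fix k
  have "coeff (spectral_poly t) k = volterra_H k t" by (simp add: volterra_H_def)
  also have "\<dots> = coeff (1 + (\<Sum>i=1..2*g+1. monom (volterra_H i t) i)) k"
    using volterra_H_0[OF assms] volterra_H_eq_0[OF assms, of k]
    by (auto simp: coeff_sum_monom simp del: sum.cl_ivl_Suc)
  finally show "coeff (spectral_poly t) k =
    coeff (1 + (\<Sum>i=1..2*g+1. monom (volterra_H i t) i)) k" .
qed

lemma polynomial_on_phase_space_sum:
  assumes "finite A" "\<And>j. j \<in> A \<Longrightarrow> polynomial_on_phase_space g (f j)"
  shows "polynomial_on_phase_space g (\<lambda>t. \<Sum>j\<in>A. f j t)"
  using assms by (induction A) (auto intro: polynomial_on_phase_space.intros)

text \<open>The convolution sums for \<open>volterra_H\<close> also use index 0 and indices past the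
  coordinate range. There the coefficients are constant on \<open>phase_space g\<close> (1, 2 or 0),
  so \<open>cong\<close> reduces them to \<open>const\<close>.\<close>

lemma polynomial_on_phase_space_coeff:
  shows polynomial_on_phase_space_coeff_P:
      "polynomial_on_phase_space g (\<lambda>(P, Q, R). coeff P i)"
    and polynomial_on_phase_space_coeff_Q:
      "polynomial_on_phase_space g (\<lambda>(P, Q, R). coeff Q i)"
    and polynomial_on_phase_space_coeff_R:
      "polynomial_on_phase_space g (\<lambda>(P, Q, R). coeff R i)"
proof -
  have const: "polynomial_on_phase_space g h" if "\<And>t. t \<in> phase_space g \<Longrightarrow> h t = c" for h c
    using polynomial_on_phase_space.const that by (rule polynomial_on_phase_space.cong)
  show "polynomial_on_phase_space g (\<lambda>(P, Q, R). coeff P i)"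
  proof (cases "i \<in> {1..g}")
    case False
    then show ?thesis
      by (intro const[where c = "if i = 0 then 1 else 0"]) (auto simp: phase_space_iff)
  qed (rule polynomial_on_phase_space.p)
  show "polynomial_on_phase_space g (\<lambda>(P, Q, R). coeff Q i)"
  proof (cases "i \<in> {1..g}")
    case False
    then show ?thesis
      by (intro const[where c = "if i = 0 then 2 else 0"]) (auto simp: phase_space_iff)
  qed (rule polynomial_on_phase_space.q)
  show "polynomial_on_phase_space g (\<lambda>(P, Q, R). coeff R i)"
  proof (cases "i \<in> {1..g+1}")
    case False
    then show ?thesis
      by (intro const[where c = 0]) (auto simp: phase_space_iff not_le Suc_le_eq)
  qed (rule polynomial_on_phase_space.r)
qed

lemma polynomial_on_phase_space_volterra_H:
  "polynomial_on_phase_space g (volterra_H i)"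
proof -
  \<comment> \<open>Each factor is written as a coordinate function applied to t, so that the
    closure rules match it directly.\<close>
  have "volterra_H i = (\<lambda>t.
      (\<Sum>j\<le>i. (\<lambda>(P, Q, R). coeff P j) t * (\<lambda>(P, Q, R). coeff P (i - j)) t) +
      (\<Sum>j\<le>i. (\<lambda>(P, Q, R). coeff Q j) t * (\<lambda>(P, Q, R). coeff R (i - j)) t))"
    by (auto simp: volterra_H_expand)
  moreover have "polynomial_on_phase_space g \<dots>"
    by (intro polynomial_on_phase_space.add polynomial_on_phase_space_sum
        polynomial_on_phase_space.mult polynomial_on_phase_space_coeff finite_atMost)
  ultimately show ?thesis by (simp only:)
qed

theorem proposition3p4:
  fixes g :: nat
  assumes "g \<ge> 1"
  shows "(\<forall>t \<in> volterra_domain g.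
            lax_L t ** lax_M t = lax_M t ** lax_L (volterra t))
       \<and> (\<forall>t \<in> volterra_domain g. \<forall>t' \<in> phase_space g.
            lax_L t ** lax_M t = lax_M t ** lax_L t' \<longrightarrow> t' = volterra t)
       \<and> (\<forall>t \<in> phase_space g.
            spectral_poly t = 1 + (\<Sum>i=1..2*g+1. monom (volterra_H i t) i))
       \<and> (\<forall>i \<in> {1..2*g+1}. polynomial_on_phase_space g (volterra_H i))
       \<and> (\<forall>i \<in> {1..2*g+1}. \<forall>t \<in> volterra_domain g.
            volterra_H i (volterra t) = volterra_H i t)"
proof (intro conjI ballI impI)
  fix t assume t: "t \<in> volterra_domain g"
  show lax: "lax_L t ** lax_M t = lax_M t ** lax_L (volterra t)"
    using t by (rule volterra_lax_equation)
  \<comment> \<open>Invariance uses only the Lax equation: both sides are coefficients of the same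
    spectral polynomial.\<close>
  show "volterra_H i (volterra t) = volterra_H i t" for i
    by (simp add: volterra_H_def spectral_poly_eqI[OF lax])
  show "t' = volterra t" if "lax_L t ** lax_M t = lax_M t ** lax_L t'" for t'
    using t that by (intro lax_equation_unique) (simp_all add: volterra_domain_def)
qed (erule spectral_poly_expansion, rule polynomial_on_phase_space_volterra_H)

end
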